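(* Let $(W,S)$ be a Coxeter system (with $S$ finite) and suppose $(W,S)$ has finite hypergraph index $h\ge 1$. Then there exist subsets $S\supset T_1\supset T_2\supset\dots\supset T_h$ such that, for each $1\le i\le h$, the subsystem $(W_{T_i},T_i)$ has hypergraph index $h-i$.
   Context: Coxeter systems: $W=\langle S\mid (st)^{m_{st}}=1\rangle$ with $S$ finite, $m_{ss}=1$ and $m_{st}=m_{ts}\in\{2,3,\dots\}\cup\{\infty\}$ for $s\neq t$ ($\infty$ meaning that $st$ has infinite order). For $T\subseteq S$, $W_T=\langle T\rangle$, and $(W_T,T)$ is a Coxeter system. $T$ is spherical if $W_T$ is finite and nonspherical otherwise; minimal nonspherical if it is nonspherical but all its proper subsets are spherical; irreducible if it has no nontrivial partition into two disjoint commuting subsets; affine if $(W_T,T)$ is affine, i.e. $T$ is the set of reflections in the faces of a compact polytope in Euclidean space. For $A,B\subseteq S$, $A\times B$ denotes $A\cup B$ where $A$ and $B$ are disjoint commuting subsets of $S$. Hypergraph index: The wide subsets $\Omega(S)$ are the maximal elements (under inclusion) of the collection of subsets of $S$ of the form $A\times B$ such that either $A$ and $B$ are both nonspherical, or $A$ is irreducible affine of cardinality $\ge 3$ and $B$ is spherical (possibly empty). The slab subsets $\Psi(S)$ are the maximal elements of the collection of subsets of $S$ of the form $A\times K$ where $A$ is minimal nonspherical, $K$ is a nonempty spherical subset commuting with $A$, and there is no $T\in\Omega(S)$ with $A\times K\subseteq T$. Put $\Lambda_{-1}(S)=\varnothing$ and $\Lambda_0(S)=\Omega(S)\cup\Psi(S)$.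 For $i\ge 0$ and $T,T'\in\Lambda_i(S)$, write $T\equiv_i T'$ if there are $T=T_0,T_1,\dots,T_n=T'$ in $\Lambda_i(S)$ with $T_j\cap T_{j+1}$ nonspherical for $0\le j<n$; then $\Lambda_{i+1}(S)$ is the set of all unions $\bigcup_{T\in C}T$ with $C$ an $\equiv_i$-equivalence class in $\Lambda_i(S)$. The hypergraph index is $h(W,S)=h\in\mathbb{N}\cup\{0\}$ if $S\in\Lambda_h(S)\setminus\Lambda_{h-1}(S)$ and $\Omega(S)\neq\varnothing$; if no such $h$ exists, or $\Omega(S)=\varnothing$, then $h(W,S)=\infty$. For a subsystem $(W_T,T)$ these definitions are applied with $T$ in place of $S$. *)

theory Defs
  imports
    "HOL-Library.Extended_Nat"
    "HOL-Algebra.Generated_Groups"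
    "HOL-Algebra.Group_Action"
    "Jordan_Normal_Form.Matrix"
begin

section \<open>Coxeter systems\<close>

text \<open>A word is a list of signed letters: (s, True) stands for the generator s and
  (s, False) for its formal inverse.\<close>

type_synonym 'g word = "('g \<times> bool) list"

fun word_value :: "('g, 'x) monoid_scheme \<Rightarrow> 'g word \<Rightarrow> 'g" where
  "word_value G [] = \<one>\<^bsub>G\<^esub>"
| "word_value G ((s, e) # w) = (if e then s else inv\<^bsub>G\<^esub> s) \<otimes>\<^bsub>G\<^esub> word_value G w"

text \<open>Equality of words in the abstract group with generators \<open>S\<close> and relators \<open>R\<close>.\<close>

inductive pres_eq :: "'g set \<Rightarrow> 'g word set \<Rightarrow> 'g word \<Rightarrow> 'g word \<Rightarrow> bool"
  for S :: "'g set" and R :: "'g word set" where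
  refl: "pres_eq S R w w"
| sym: "pres_eq S R v w \<Longrightarrow> pres_eq S R w v"
| trans: "pres_eq S R u v \<Longrightarrow> pres_eq S R v w \<Longrightarrow> pres_eq S R u w"
| cancel: "s \<in> S \<Longrightarrow> pres_eq S R (u @ [(s, e), (s, \<not> e)] @ v) (u @ v)"
| relator: "r \<in> R \<Longrightarrow> pres_eq S R (u @ r @ v) (u @ v)"

definition has_presentation :: "('g, 'x) monoid_scheme \<Rightarrow> 'g set \<Rightarrow> 'g word set \<Rightarrow> bool" where
  "has_presentation G S R \<longleftrightarrow>
     S \<subseteq> carrier G \<and> generate G S = carrier G \<and>
     (\<forall>w \<in> lists (S \<times> UNIV). word_value G w = \<one>\<^bsub>G\<^esub> \<longleftrightarrow> pres_eq S R w [])"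

text \<open>Pairs with \<open>m s t = \<infinity>\<close> contribute no relator.\<close>

definition coxeter_relators :: "'g set \<Rightarrow> ('g \<Rightarrow> 'g \<Rightarrow> enat) \<Rightarrow> 'g word set" where
  "coxeter_relators S m =
     {concat (replicate k [(s, True), (t, True)]) | s t k. s \<in> S \<and> t \<in> S \<and> m s t = enat k}"

locale coxeter_system = group G for G (structure) +
  fixes S and m :: "'a \<Rightarrow> 'a \<Rightarrow> enat"
  assumes finite_generators: "finite S"
    and m_diag: "s \<in> S \<Longrightarrow> m s s = 1"
    and m_sym: "\<lbrakk>s \<in> S; t \<in> S\<rbrakk> \<Longrightarrow> m s t = m t s"
    and m_off_diag: "\<lbrakk>s \<in> S; t \<in> S; s \<noteq> t\<rbrakk> \<Longrightarrow> 2 \<le> m s t"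
    and presentation: "has_presentation G S (coxeter_relators S m)"

section \<open>Subsets of the generating set\<close>

text \<open>The group \<open>W\<^sub>T\<close> is \<open>generate G T\<close>. The notions below refer only to the subgroups
  generated by subsets of \<open>T\<close>, so for the subsystem \<open>(W\<^sub>T, T)\<close> they can be evaluated
  in the ambient group \<open>G\<close>.\<close>

definition spherical :: "('g, 'x) monoid_scheme \<Rightarrow> 'g set \<Rightarrow> bool" where
  "spherical G T \<longleftrightarrow> finite (generate G T)"

definition minimal_nonspherical :: "('g, 'x) monoid_scheme \<Rightarrow> 'g set \<Rightarrow> bool" where
  "minimal_nonspherical G T \<longleftrightarrow> \<not> spherical G T \<and> (\<forall>U. U \<subset> T \<longrightarrow> spherical G U)"

definition disjoint_commuting :: "('g, 'x) monoid_scheme \<Rightarrow> 'g set \<Rightarrow> 'g set \<Rightarrow> bool" where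
  "disjoint_commuting G A B \<longleftrightarrow>
     A \<inter> B = {} \<and> (\<forall>a \<in> A. \<forall>b \<in> B. a \<otimes>\<^bsub>G\<^esub> b = b \<otimes>\<^bsub>G\<^esub> a)"

definition irreducible_subset :: "('g, 'x) monoid_scheme \<Rightarrow> 'g set \<Rightarrow> bool" where
  "irreducible_subset G T \<longleftrightarrow>
     \<not> (\<exists>A B. A \<noteq> {} \<and> B \<noteq> {} \<and> A \<union> B = T \<and> disjoint_commuting G A B)"

text \<open>Euclidean n-space is \<open>carrier_vec n\<close> over the reals. A family of unit normals \<open>u s\<close> and
  offsets \<open>c s\<close>, for \<open>s \<in> T\<close>, describes the polyhedron of all \<open>x\<close> with
  \<open>u s \<bullet> x \<le> c s\<close>.\<close>

definition polyhedron_of :: "nat \<Rightarrow> 'g set \<Rightarrow> ('g \<Rightarrow> real vec) \<Rightarrow> ('g \<Rightarrow> real) \<Rightarrow> real vec set" where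
  "polyhedron_of n T u c = {x \<in> carrier_vec n. \<forall>s \<in> T. u s \<bullet> x \<le> c s}"

definition polyhedron_interior :: "nat \<Rightarrow> 'g set \<Rightarrow> ('g \<Rightarrow> real vec) \<Rightarrow> ('g \<Rightarrow> real) \<Rightarrow> real vec set" where
  "polyhedron_interior n T u c = {x \<in> carrier_vec n. \<forall>s \<in> T. u s \<bullet> x < c s}"

text \<open>The last condition says that the hyperplanes of distinct elements of \<open>T\<close> cut out
  distinct faces of codimension one, so that \<open>T\<close> indexes these faces bijectively.\<close>

definition compact_polytope :: "nat \<Rightarrow> 'g set \<Rightarrow> ('g \<Rightarrow> real vec) \<Rightarrow> ('g \<Rightarrow> real) \<Rightarrow> bool" where
  "compact_polytope n T u c \<longleftrightarrow>
     finite T \<and>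
     (\<forall>s \<in> T. u s \<in> carrier_vec n \<and> u s \<bullet> u s = 1) \<and>
     (\<exists>b. \<forall>x \<in> polyhedron_of n T u c. x \<bullet> x \<le> b) \<and>
     polyhedron_interior n T u c \<noteq> {} \<and>
     (\<forall>s \<in> T. \<exists>x \<in> carrier_vec n. u s \<bullet> x = c s \<and> (\<forall>t \<in> T - {s}. u t \<bullet> x < c t))"

definition hyperplane_reflection :: "real vec \<Rightarrow> real \<Rightarrow> real vec \<Rightarrow> real vec" where
  "hyperplane_reflection v a x = x - (2 * (v \<bullet> x - a)) \<cdot>\<^sub>v v"

text \<open>\<open>T\<close> is affine if \<open>W\<^sub>T\<close> acts on some Euclidean space so that the elements of \<open>T\<close> are the
  reflections in the faces of codimension one of a compact polytope. As usual for Euclidean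
  reflection groups, the polytope is a fundamental chamber: no nontrivial element maps an
  interior point to an interior point. Hence the action is faithful and discrete. Without this
  clause a generic simplex, whose facet reflections may generate a nondiscrete free product
  of groups of order two, would make non-affine systems qualify.\<close>

definition affine_subset :: "('g, 'x) monoid_scheme \<Rightarrow> 'g set \<Rightarrow> bool" where
  "affine_subset G T \<longleftrightarrow>
     (\<exists>n u c \<rho>.
        compact_polytope n T u c \<and>
        group_action (G\<lparr>carrier := generate G T\<rparr>) (carrier_vec n) \<rho> \<and>
        (\<forall>s \<in> T. \<forall>x \<in> carrier_vec n. \<rho> s x = hyperplane_reflection (u s) (c s) x) \<and>
        (\<forall>g \<in> generate G T. g \<noteq> \<one>\<^bsub>G\<^esub> \<longrightarrow>
           \<rho> g ` polyhedron_interior n T u c \<inter> polyhedron_interior n T u c = {}))"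

section \<open>The hypergraph index\<close>

definition maximal_sets :: "'b set set \<Rightarrow> 'b set set" where
  "maximal_sets \<C> = {X \<in> \<C>. \<forall>Y \<in> \<C>. X \<subseteq> Y \<longrightarrow> Y = X}"

definition wide_subsets :: "('g, 'x) monoid_scheme \<Rightarrow> 'g set \<Rightarrow> 'g set set" where
  "wide_subsets G S = maximal_sets
     {A \<union> B | A B. A \<subseteq> S \<and> B \<subseteq> S \<and> disjoint_commuting G A B \<and>
        (\<not> spherical G A \<and> \<not> spherical G B \<or>
         irreducible_subset G A \<and> affine_subset G A \<and> 3 \<le> card A \<and> spherical G B)}"

definition slab_subsets :: "('g, 'x) monoid_scheme \<Rightarrow> 'g set \<Rightarrow> 'g set set" where
  "slab_subsets G S = maximal_sets
     {A \<union> K | A K. A \<subseteq> S \<and> K \<subseteq> S \<and> disjoint_commuting G A K \<and>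
        minimal_nonspherical G A \<and> K \<noteq> {} \<and> spherical G K \<and>
        \<not> (\<exists>T \<in> wide_subsets G S. A \<union> K \<subseteq> T)}"

definition nonspherical_link :: "('g, 'x) monoid_scheme \<Rightarrow> 'g set set \<Rightarrow> ('g set \<times> 'g set) set" where
  "nonspherical_link G L = {(T, T'). T \<in> L \<and> T' \<in> L \<and> \<not> spherical G (T \<inter> T')}"

definition link_equiv :: "('g, 'x) monoid_scheme \<Rightarrow> 'g set set \<Rightarrow> ('g set \<times> 'g set) set" where
  "link_equiv G L = (nonspherical_link G L)\<^sup>* \<inter> L \<times> L"

fun hyper_level :: "('g, 'x) monoid_scheme \<Rightarrow> 'g set \<Rightarrow> nat \<Rightarrow> 'g set set" where
  "hyper_level G S 0 = wide_subsets G S \<union> slab_subsets G S"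
| "hyper_level G S (Suc i) =
     {\<Union> C | C. C \<in> hyper_level G S i // link_equiv G (hyper_level G S i)}"

text \<open>The level with index -1 is empty, so \<open>first_level G S 0\<close> only requires that \<open>S\<close>
  belong to level 0.\<close>

definition first_level :: "('g, 'x) monoid_scheme \<Rightarrow> 'g set \<Rightarrow> nat \<Rightarrow> bool" where
  "first_level G S h \<longleftrightarrow>
     S \<in> hyper_level G S h \<and> (\<forall>i. h = Suc i \<longrightarrow> S \<notin> hyper_level G S i)"

text \<open>There is at most one \<open>h\<close> with \<open>first_level G S h\<close>, because \<open>S\<close> belongs to every level
  after the first one that contains it (lemma \<open>first_level_unique\<close>).\<close>

definition hypergraph_index :: "('g, 'x) monoid_scheme \<Rightarrow> 'g set \<Rightarrow> enat" where
  "hypergraph_index G S =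
     (if wide_subsets G S \<noteq> {} \<and> (\<exists>h. first_level G S h) then enat (THE h. first_level G S h)
      else \<infinity>)"

lemma hyper_level_subset: "T \<in> hyper_level G S i \<Longrightarrow> T \<subseteq> S"
proof (induction i arbitrary: T)
  case 0
  then show ?case by (auto simp: wide_subsets_def slab_subsets_def maximal_sets_def)
next
  case (Suc i)
  then obtain C where C: "T = \<Union> C" "C \<in> hyper_level G S i // link_equiv G (hyper_level G S i)"
    by auto
  then have "C \<subseteq> hyper_level G S i"
    by (auto simp: quotient_def link_equiv_def)
  with C(1) Suc.IH show ?case by blast
qed

lemma hyper_level_Suc: 
  assumes "S \<in> hyper_level G S i"
  shows "S \<in> hyper_level G S (Suc i)"
proof -
  let ?L = "hyper_level G S i"
  let ?C = "link_equiv G ?L `` {S}"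
  have "?C \<in> ?L // link_equiv G ?L"
    using assms by (rule quotientI)
  moreover have "S \<in> ?C" "?C \<subseteq> ?L"
    using assms by (auto simp: link_equiv_def)
  then have "\<Union> ?C = S"
    using hyper_level_subset[of _ G S i] by blast
  ultimately show ?thesis
    by (metis (mono_tags, lifting) hyper_level.simps(2) mem_Collect_eq)
qed

lemma first_level_unique:
  assumes "first_level G S h" "first_level G S k"
  shows "h = k"
proof -
  have up: "S \<in> hyper_level G S j" if "S \<in> hyper_level G S i" "i \<le> j" for i j
    using that(2,1) by (induction j rule: dec_induct) (auto intro: hyper_level_Suc simp del: hyper_level.simps)
  have "\<not> i < j" if "first_level G S i" "first_level G S j" for i j
  proof
    assume "i < j"
    then obtain l where "j = Suc l" "i \<le> l" by (cases j) auto
    with that up show False by (auto simp: first_level_def simp del: hyper_level.simps)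
  qed
  with assms show ?thesis by (meson linorder_neqE_nat)
qed

end

theory Submission
  imports Defs
begin

text \<open>It suffices to lower the index once: if \<open>S\<close> has index \<open>k + 1\<close>, some proper subset has index
  \<open>k\<close>, and this step can be repeated with the subset in place of \<open>S\<close>. The subset is found among
  the members of level \<open>k\<close> of \<open>S\<close> itself.

  The levels of a subset \<open>T\<close> and those of \<open>S\<close> can be compared up to inclusion. Each member of level
  \<open>i\<close> of \<open>T\<close> lies in a member of level \<open>i\<close> of \<open>S\<close> (\<open>hyper_level_mono\<close>), and each member of
  level \<open>i\<close> of \<open>S\<close> that lies in \<open>T\<close> lies in a member of level \<open>i\<close> of \<open>T\<close>
  (\<open>hyper_level_restrict\<close>). The reason is that enlarging sets preserves nonspherical intersections,
  so such a comparison passes from one level to the next (\<open>link_class_Union_mono\<close>). Hence a member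
  \<open>T\<close> of level \<open>k\<close> of \<open>S\<close> belongs to its own level \<open>k\<close>, and to its own level \<open>k - 1\<close>
  only if it is contained in a member of level \<open>k - 1\<close> of \<open>S\<close>. If this happened for every \<open>T\<close>
  in level \<open>k\<close>, the chains that join these members to all of \<open>S\<close> would already be visible one
  level earlier, and \<open>S\<close> would have index at most \<open>k\<close>
  (\<open>new_member_of_previous_level\<close>). So some \<open>T\<close> appears first at level \<open>k\<close>.

  The index of \<open>T\<close> is finite only if \<open>T\<close> has a wide subset. This holds because two slabs with
  nonspherical intersection are equal (\<open>linked_slabs_equal\<close>): slabs by themselves never merge into
  anything new, so a member of any level contains a wide subset or is a slab
  (\<open>hyper_level_wide_or_slab\<close>), and a slab is present from level 0 on.\<close>

section \<open>Spherical subsets\<close>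

lemma (in group) spherical_mono:
  assumes "spherical G B" "A \<subseteq> B"
  shows "spherical G A"
  using assms mono_generate[of A B] unfolding spherical_def by (blast intro: finite_subset)

lemma disjoint_commuting_mono:
  assumes "disjoint_commuting G A B" "A' \<subseteq> A" "B' \<subseteq> B"
  shows "disjoint_commuting G A' B'"
  using assms unfolding disjoint_commuting_def by blast

lemma (in group) generate_commute_right:
  assumes "x \<in> carrier G" "B \<subseteq> carrier G" "\<forall>b \<in> B. x \<otimes> b = b \<otimes> x" "y \<in> generate G B"
  shows "x \<otimes> y = y \<otimes> x"
  using assms(4)
proof induction
  case one
  then show ?case using assms(1) by simp
next
  case (incl h)
  then show ?case using assms(3) by blast
next
  case (inv h)
  then have "h \<in> carrier G" "x \<otimes> h = h \<otimes> x" using assms(2,3) by auto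
  then show ?case using assms(1) by (metis inv_closed inv_solve_left inv_solve_right m_assoc m_closed)
next
  case (eng h1 h2)
  have c: "h1 \<in> carrier G" "h2 \<in> carrier G"
    using eng.hyps generate_in_carrier[OF assms(2)] by auto
  have "x \<otimes> (h1 \<otimes> h2) = (h1 \<otimes> x) \<otimes> h2"
    using c assms(1) eng.IH(1) by (simp flip: m_assoc)
  also have "\<dots> = (h1 \<otimes> h2) \<otimes> x"
    using c assms(1) eng.IH(2) by (simp add: m_assoc)
  finally show ?case .
qed

text \<open>The products of an element of \<open>generate G A\<close> with an element of \<open>generate G B\<close> form a
  subgroup when \<open>A\<close> and \<open>B\<close> commute, and there are finitely many of them.\<close>

lemma (in group) spherical_Un:
  assumes "A \<subseteq> carrier G" "B \<subseteq> carrier G" "disjoint_commuting G A B"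
    and "spherical G A" "spherical G B"
  shows "spherical G (A \<union> B)"
proof -
  let ?P = "(\<lambda>(x, y). x \<otimes> y) ` (generate G A \<times> generate G B)"
  have comm: "x \<otimes> y = y \<otimes> x" if "x \<in> generate G A" "y \<in> generate G B" for x y
  proof -
    have "b \<otimes> x = x \<otimes> b" if "b \<in> B" for b
      using that assms \<open>x \<in> generate G A\<close>
      by (intro generate_commute_right[of b A x]) (auto simp: disjoint_commuting_def)
    then show ?thesis
      using that assms generate_in_carrier[OF assms(1)] generate_commute_right[of x B y] by auto
  qed
  have car: "generate G A \<subseteq> carrier G" "generate G B \<subseteq> carrier G"
    using assms generate_incl by auto
  have prodI: "x \<otimes> y \<in> ?P" if "x \<in> generate G A" "y \<in> generate G B" for x y
    using that by auto
  have one: "\<one> \<in> generate G A" "\<one> \<in> generate G B" by (rule generate.one)+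
  have factor: "x \<in> ?P" if "x \<in> generate G A \<union> generate G B" for x
  proof -
    have "x \<in> carrier G" using that car by blast
    then show ?thesis using that prodI[of x \<one>] prodI[of \<one> x] one by auto
  qed
  have "z \<in> ?P" if "z \<in> generate G (A \<union> B)" for z
    using that
  proof induction
    case one
    show ?case using factor \<open>\<one> \<in> generate G A\<close> by blast
  next
    case (incl h)
    then show ?case by (intro factor) (blast intro: generate.incl)
  next
    case (inv h)
    then show ?case by (intro factor) (blast intro: generate.inv)
  next
    case (eng h1 h2)
    then obtain a b a' b' where ab: "h1 = a \<otimes> b" "h2 = a' \<otimes> b'"
      "a \<in> generate G A" "a' \<in> generate G A" "b \<in> generate G B" "b' \<in> generate G B" by auto
    then have c: "a \<in> carrier G" "a' \<in> carrier G" "b \<in> carrier G" "b' \<in> carrier G"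
      using car by auto
    have "h1 \<otimes> h2 = a \<otimes> (b \<otimes> a') \<otimes> b'" using c ab by (simp add: m_assoc)
    also have "\<dots> = a \<otimes> (a' \<otimes> b) \<otimes> b'" using ab comm[of a' b] by simp
    also have "\<dots> = (a \<otimes> a') \<otimes> (b \<otimes> b')" using c by (simp add: m_assoc)
    finally show ?case using ab prodI generate.eng by metis
  qed
  then have "generate G (A \<union> B) \<subseteq> ?P" by blast
  moreover have "finite ?P" using assms(4,5) unfolding spherical_def by blast
  ultimately show ?thesis unfolding spherical_def by (rule finite_subset)
qed

text \<open>A nonspherical subset of \<open>A \<times> K\<close> cannot split as a spherical subset of \<open>A\<close> times a
  spherical subset of \<open>K\<close>, so it uses up all of \<open>A\<close>.\<close>

lemma (in group) minimal_nonspherical_factor_subset: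
  assumes "A \<subseteq> carrier G" "K \<subseteq> carrier G" "disjoint_commuting G A K"
    and "minimal_nonspherical G A" "spherical G K"
    and "N \<subseteq> A \<union> K" "\<not> spherical G N"
  shows "A \<subseteq> N"
proof (rule ccontr)
  assume "\<not> A \<subseteq> N"
  then have "N \<inter> A \<subset> A" by blast
  then have "spherical G (N \<inter> A)" using assms(4) unfolding minimal_nonspherical_def by blast
  moreover have "spherical G (N \<inter> K)" using assms(5) spherical_mono by blast
  moreover have "disjoint_commuting G (N \<inter> A) (N \<inter> K)"
    using assms(3) by (rule disjoint_commuting_mono) auto
  moreover have "N \<inter> A \<subseteq> carrier G" "N \<inter> K \<subseteq> carrier G" using assms(1,2) by auto
  ultimately have "spherical G ((N \<inter> A) \<union> (N \<inter> K))" by (intro spherical_Un) auto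
  moreover have "(N \<inter> A) \<union> (N \<inter> K) = N" using assms(6) by blast
  ultimately show False using assms(7) by simp
qed


section \<open>Wide and slab subsets of nested sets of generators\<close>

lemma maximal_sets_above:
  assumes "finite S" "\<And>Y. Y \<in> \<C> \<Longrightarrow> Y \<subseteq> S" "X \<in> \<C>"
  obtains M where "M \<in> maximal_sets \<C>" "X \<subseteq> M"
proof -
  have "finite \<C>"
    using assms(1,2) by (intro finite_subset[of \<C> "Pow S"]) auto
  from finite_has_maximal2[OF this assms(3)]
  obtain M where "M \<in> \<C>" "X \<subseteq> M" "\<forall>Y \<in> \<C>. M \<subseteq> Y \<longrightarrow> M = Y" by blast
  then show ?thesis by (intro that[of M]) (auto simp: maximal_sets_def)
qed

text \<open>Maximality is what makes wide and slab subsets depend on the ambient set of generators in a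
  non-monotone way. The families before passing to maximal elements are easier to compare between
  \<open>S\<close> and a subset of \<open>S\<close>, so they get their own names.\<close>

definition wide_products :: "('g, 'x) monoid_scheme \<Rightarrow> 'g set \<Rightarrow> 'g set set" where
  "wide_products G S =
     {A \<union> B | A B. A \<subseteq> S \<and> B \<subseteq> S \<and> disjoint_commuting G A B \<and>
        (\<not> spherical G A \<and> \<not> spherical G B \<or>
         irreducible_subset G A \<and> affine_subset G A \<and> 3 \<le> card A \<and> spherical G B)}"

definition slab_products :: "('g, 'x) monoid_scheme \<Rightarrow> 'g set \<Rightarrow> 'g set set" where
  "slab_products G S =
     {A \<union> K | A K. A \<subseteq> S \<and> K \<subseteq> S \<and> disjoint_commuting G A K \<and>
        minimal_nonspherical G A \<and> K \<noteq> {} \<and> spherical G K \<and>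
        \<not> (\<exists>T \<in> wide_subsets G S. A \<union> K \<subseteq> T)}"

lemma wide_productsI_nonspherical:
  assumes "A \<subseteq> S" "B \<subseteq> S" "disjoint_commuting G A B" "\<not> spherical G A" "\<not> spherical G B"
  shows "A \<union> B \<in> wide_products G S"
  unfolding wide_products_def mem_Collect_eq
  by (rule exI[of _ A], rule exI[of _ B]) (simp add: assms)

lemma slab_productsI:
  assumes "A \<subseteq> S" "K \<subseteq> S" "disjoint_commuting G A K" "minimal_nonspherical G A"
    and "K \<noteq> {}" "spherical G K" "\<not> (\<exists>T \<in> wide_subsets G S. A \<union> K \<subseteq> T)"
  shows "A \<union> K \<in> slab_products G S"
  unfolding slab_products_def mem_Collect_eq
  by (rule exI[of _ A], rule exI[of _ K]) (intro conjI HOL.refl assms)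

lemma slab_productsE:
  assumes "X \<in> slab_products G S"
  obtains A K where "X = A \<union> K" "A \<subseteq> S" "K \<subseteq> S" "disjoint_commuting G A K"
    "minimal_nonspherical G A" "K \<noteq> {}" "spherical G K"
    "\<not> (\<exists>T \<in> wide_subsets G S. A \<union> K \<subseteq> T)"
  using assms unfolding slab_products_def mem_Collect_eq by (elim exE conjE) rule

lemma wide_subsets_eq: "wide_subsets G S = maximal_sets (wide_products G S)"
  unfolding wide_subsets_def wide_products_def ..

lemma slab_subsets_eq: "slab_subsets G S = maximal_sets (slab_products G S)"
  unfolding slab_subsets_def slab_products_def ..

lemma wide_products_restrict:
  assumes "T \<subseteq> S"
  shows "wide_products G T = {X \<in> wide_products G S. X \<subseteq> T}"
proof -
  have "X \<in> wide_products G T \<longleftrightarrow> X \<in> wide_products G S \<and> X \<subseteq> T" for X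
  proof
    assume "X \<in> wide_products G T"
    then show "X \<in> wide_products G S \<and> X \<subseteq> T"
      using assms unfolding wide_products_def by blast
  next
    assume "X \<in> wide_products G S \<and> X \<subseteq> T"
    then show "X \<in> wide_products G T"
      unfolding wide_products_def mem_Collect_eq by (metis le_sup_iff)
  qed
  then show ?thesis by blast
qed

lemma wide_subset_above:
  assumes "finite S" "X \<in> wide_products G S"
  shows "\<exists>M \<in> wide_subsets G S. X \<subseteq> M"
proof -
  have "Y \<subseteq> S" if "Y \<in> wide_products G S" for Y
    using that unfolding wide_products_def by auto
  from maximal_sets_above[OF assms(1) this assms(2)] show ?thesis
    unfolding wide_subsets_eq by blast
qed

lemma slab_subset_above:
  assumes "finite S" "X \<in> slab_products G S"
  shows "\<exists>M \<in> slab_subsets G S. X \<subseteq> M"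
proof -
  have "Y \<subseteq> S" if "Y \<in> slab_products G S" for Y
    using that unfolding slab_products_def by auto
  from maximal_sets_above[OF assms(1) this assms(2)] show ?thesis
    unfolding slab_subsets_eq by blast
qed

lemma wide_subset_product: "X \<in> wide_subsets G S \<Longrightarrow> X \<in> wide_products G S"
  unfolding wide_subsets_eq maximal_sets_def by simp

lemma slab_subset_product: "X \<in> slab_subsets G S \<Longrightarrow> X \<in> slab_products G S"
  unfolding slab_subsets_eq maximal_sets_def by simp

text \<open>A wide subset of \<open>T\<close> need not be wide in \<open>S\<close>, where it may fail to be maximal. For the
  condition that excludes slabs, only containment in some wide subset matters, and this persists.\<close>

lemma below_wide_subset_mono:
  assumes "finite S" "T \<subseteq> S" "\<exists>V \<in> wide_subsets G T. X \<subseteq> V"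
  shows "\<exists>V \<in> wide_subsets G S. X \<subseteq> V"
proof -
  obtain V where V: "V \<in> wide_subsets G T" "X \<subseteq> V" using assms(3) by (rule bexE)
  then have "V \<in> wide_products G S"
    using wide_subset_product[OF V(1)] wide_products_restrict[OF assms(2)] by blast
  then obtain M where "M \<in> wide_subsets G S" "V \<subseteq> M"
    using wide_subset_above[OF assms(1)] by blast
  with V(2) show ?thesis by (meson subset_trans)
qed

lemma slab_products_restrict_subset:
  assumes "finite S" "T \<subseteq> S" "X \<in> slab_products G S" "X \<subseteq> T"
  shows "X \<in> slab_products G T"
proof -
  obtain A K where X: "X = A \<union> K" "A \<subseteq> S" "K \<subseteq> S" "disjoint_commuting G A K"
    "minimal_nonspherical G A" "K \<noteq> {}" "spherical G K"
    "\<not> (\<exists>T \<in> wide_subsets G S. A \<union> K \<subseteq> T)"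
    using assms(3) by (rule slab_productsE)
  have "\<not> (\<exists>V \<in> wide_subsets G T. A \<union> K \<subseteq> V)"
    using X(8) below_wide_subset_mono[OF assms(1,2)] by (rule contrapos_nn)
  moreover have "A \<subseteq> T" "K \<subseteq> T" using X(1) assms(4) by auto
  ultimately show ?thesis unfolding X(1) using X(4-7) by (intro slab_productsI)
qed

text \<open>A slab of \<open>T\<close> can be swallowed by a wide subset of \<open>S\<close> that is not contained in \<open>T\<close>;
  otherwise it is still a candidate for a slab of \<open>S\<close>.\<close>

lemma hyper_level_0_mono:
  assumes "finite S" "T \<subseteq> S" "X \<in> hyper_level G T 0"
  shows "\<exists>Y \<in> hyper_level G S 0. X \<subseteq> Y"
proof (cases "\<exists>M \<in> wide_subsets G S. X \<subseteq> M")
  case True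
  then show ?thesis by auto
next
  case False
  then have "X \<notin> wide_subsets G T" using below_wide_subset_mono[OF assms(1,2), of G X] by auto
  then have "X \<in> slab_products G T" using assms(3) slab_subset_product by auto
  then obtain A K where X: "X = A \<union> K" "A \<subseteq> T" "K \<subseteq> T" "disjoint_commuting G A K"
    "minimal_nonspherical G A" "K \<noteq> {}" "spherical G K"
    "\<not> (\<exists>V \<in> wide_subsets G T. A \<union> K \<subseteq> V)"
    by (rule slab_productsE)
  have "X \<in> slab_products G S"
    using False assms(2) X(2,3) X(4-7) unfolding X(1) by (intro slab_productsI) auto
  then obtain M where "M \<in> slab_subsets G S" "X \<subseteq> M" using slab_subset_above[OF assms(1)] by blast
  then show ?thesis by auto
qed

lemma hyper_level_0_restrict:
  assumes "finite S" "T \<subseteq> S" "X \<in> hyper_level G S 0" "X \<subseteq> T"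
  shows "\<exists>Y \<in> hyper_level G T 0. X \<subseteq> Y"
proof -
  have fin: "finite T" using assms(1,2) finite_subset by blast
  from assms(3) consider "X \<in> wide_subsets G S" | "X \<in> slab_subsets G S" by auto
  then show ?thesis
  proof cases
    case 1
    then have "X \<in> wide_products G T"
      using wide_subset_product wide_products_restrict[OF assms(2)] assms(4) by blast
    then obtain M where "M \<in> wide_subsets G T" "X \<subseteq> M" using wide_subset_above[OF fin] by blast
    then show ?thesis by auto
  next
    case 2
    then have "X \<in> slab_products G T"
      using slab_subset_product slab_products_restrict_subset assms by blast
    then obtain M where "M \<in> slab_subsets G T" "X \<subseteq> M" using slab_subset_above[OF fin] by blast
    then show ?thesis by auto
  qed
qed

text \<open>The nonspherical intersection contains the minimal nonspherical factor of each slab, so the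
  two factors coincide, say with \<open>A\<close>. If the two spherical factors together were nonspherical,
  their product with \<open>A\<close> would lie in a wide subset, and so would both slabs. Hence this product is
  itself a candidate for a slab, and both slabs equal it by maximality.\<close>

lemma (in group) linked_slabs_equal:
  assumes "finite S" "S \<subseteq> carrier G"
    and "X \<in> slab_subsets G S" "Y \<in> slab_subsets G S" "\<not> spherical G (X \<inter> Y)"
  shows "X = Y"
proof -
  obtain A K where X: "X = A \<union> K" "A \<subseteq> S" "K \<subseteq> S" "disjoint_commuting G A K"
    "minimal_nonspherical G A" "K \<noteq> {}" "spherical G K"
    "\<not> (\<exists>T \<in> wide_subsets G S. A \<union> K \<subseteq> T)"
    using slab_subset_product[OF assms(3)] by (rule slab_productsE)
  obtain B L where Y: "Y = B \<union> L" "B \<subseteq> S" "L \<subseteq> S" "disjoint_commuting G B L"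
    "minimal_nonspherical G B" "L \<noteq> {}" "spherical G L"
    "\<not> (\<exists>T \<in> wide_subsets G S. B \<union> L \<subseteq> T)"
    using slab_subset_product[OF assms(4)] by (rule slab_productsE)
  have car: "A \<subseteq> carrier G" "K \<subseteq> carrier G" "B \<subseteq> carrier G" "L \<subseteq> carrier G"
    using X(2,3) Y(2,3) assms(2) by auto
  have nsA: "\<not> spherical G A" using X(5) unfolding minimal_nonspherical_def by simp
  have "X \<inter> Y \<subseteq> A \<union> K" using X(1) by blast
  then have "A \<subseteq> X \<inter> Y"
    by (rule minimal_nonspherical_factor_subset[OF car(1,2) X(4,5,7) _ assms(5)])
  then have "A \<subseteq> B \<union> L" using Y(1) by blast
  then have "B \<subseteq> A"
    using nsA by (rule minimal_nonspherical_factor_subset[OF car(3,4) Y(4,5,7)])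
  then have AB: "B = A"
    using X(5) Y(5) unfolding minimal_nonspherical_def by (meson psubsetI)
  have dc: "disjoint_commuting G A (K \<union> L)"
    using X(4) Y(4) AB unfolding disjoint_commuting_def by blast
  have nw: "\<not> (\<exists>T \<in> wide_subsets G S. A \<union> (K \<union> L) \<subseteq> T)"
  proof
    assume "\<exists>T \<in> wide_subsets G S. A \<union> (K \<union> L) \<subseteq> T"
    then obtain T where "T \<in> wide_subsets G S" "A \<union> (K \<union> L) \<subseteq> T" by (rule bexE)
    then have "T \<in> wide_subsets G S" "A \<union> K \<subseteq> T" by auto
    then show False using X(8) by metis
  qed
  have "A \<union> (K \<union> L) \<notin> wide_products G S"
    using nw by (rule contrapos_nn) (rule wide_subset_above[OF assms(1)])
  moreover have KL: "K \<union> L \<subseteq> S" using X(3) Y(3) by blast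
  ultimately have "spherical G (K \<union> L)"
    using wide_productsI_nonspherical[OF X(2) KL dc] nsA by metis
  moreover have "K \<union> L \<noteq> {}" using X(6) by blast
  ultimately have "A \<union> (K \<union> L) \<in> slab_products G S"
    using slab_productsI[OF X(2) KL dc X(5)] nw by metis
  moreover have "X \<subseteq> A \<union> (K \<union> L)" "Y \<subseteq> A \<union> (K \<union> L)" using X(1) Y(1) AB by auto
  moreover have "Z = M" if "Z \<in> slab_subsets G S" "M \<in> slab_products G S" "Z \<subseteq> M" for Z M
    using that unfolding slab_subsets_eq maximal_sets_def by auto
  ultimately show ?thesis using assms(3,4) by metis
qed


section \<open>Comparing the levels of nested sets of generators\<close>

text \<open>Replacing each member of a class by a larger set keeps nonspherical intersections
  nonspherical, so the larger sets stay within one class.\<close>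

lemma (in group) link_class_Union_mono:
  assumes C: "C \<in> L // link_equiv G L" and up: "\<forall>X \<in> C. \<exists>Y \<in> L'. X \<subseteq> Y"
  shows "\<exists>D \<in> L' // link_equiv G L'. \<Union> C \<subseteq> \<Union> D"
proof -
  obtain f where f: "\<And>X. X \<in> C \<Longrightarrow> f X \<in> L' \<and> X \<subseteq> f X" using up by metis
  obtain X0 where X0: "X0 \<in> L" "C = link_equiv G L `` {X0}" using C by (rule quotientE)
  have C_iff: "X \<in> C \<longleftrightarrow> (X0, X) \<in> (nonspherical_link G L)\<^sup>* \<and> X \<in> L" for X
    using X0 unfolding link_equiv_def by auto
  have "(f X0, f X) \<in> (nonspherical_link G L')\<^sup>*" if "(X0, X) \<in> (nonspherical_link G L)\<^sup>*" for X
    using that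
  proof induction
    case base
    then show ?case by simp
  next
    case (step Y Z)
    then have in_L: "Y \<in> L" "Z \<in> L" and ns: "\<not> spherical G (Y \<inter> Z)"
      unfolding nonspherical_link_def by auto
    then have "Y \<in> C" "Z \<in> C" using C_iff step.hyps by (auto intro: rtrancl_into_rtrancl)
    then have "f Y \<in> L'" "f Z \<in> L'" "Y \<inter> Z \<subseteq> f Y \<inter> f Z" using f by blast+
    then have "(f Y, f Z) \<in> nonspherical_link G L'"
      using ns spherical_mono unfolding nonspherical_link_def by blast
    with step.IH show ?case by (rule rtrancl_into_rtrancl)
  qed
  moreover have "X0 \<in> C" using C_iff X0(1) by simp
  ultimately have "f X \<in> link_equiv G L' `` {f X0}" if "X \<in> C" for X
    using that C_iff f unfolding link_equiv_def by auto
  then have "\<Union> C \<subseteq> \<Union> (link_equiv G L' `` {f X0})" using f by blast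
  moreover have "link_equiv G L' `` {f X0} \<in> L' // link_equiv G L'"
    using f \<open>X0 \<in> C\<close> by (intro quotientI) auto
  ultimately show ?thesis by blast
qed

lemma link_class_subset: "C \<in> L // link_equiv G L \<Longrightarrow> C \<subseteq> L"
  unfolding quotient_def link_equiv_def by auto

lemma hyper_level_SucE:
  assumes "X \<in> hyper_level G S (Suc i)"
  obtains C where "X = \<Union> C" "C \<in> hyper_level G S i // link_equiv G (hyper_level G S i)"
  using assms by auto

lemma (in group) class_Union_in_hyper_level_Suc:
  assumes "C \<in> L // link_equiv G L" "\<forall>X \<in> C. \<exists>Y \<in> hyper_level G S i. X \<subseteq> Y"
  shows "\<exists>Y \<in> hyper_level G S (Suc i). \<Union> C \<subseteq> Y"
  using link_class_Union_mono[OF assms] by auto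

lemma (in group) hyper_level_mono:
  assumes "finite S" "T \<subseteq> S" "X \<in> hyper_level G T i"
  shows "\<exists>Y \<in> hyper_level G S i. X \<subseteq> Y"
  using assms(3)
proof (induction i arbitrary: X)
  case 0
  then show ?case by (rule hyper_level_0_mono[OF assms(1,2)])
next
  case (Suc i)
  from Suc.prems obtain C where C: "X = \<Union> C"
    "C \<in> hyper_level G T i // link_equiv G (hyper_level G T i)" by (rule hyper_level_SucE)
  have "\<forall>Z \<in> C. \<exists>Y \<in> hyper_level G S i. Z \<subseteq> Y"
  proof
    fix Z assume "Z \<in> C"
    then have "Z \<in> hyper_level G T i" using link_class_subset[OF C(2)] by blast
    then show "\<exists>Y \<in> hyper_level G S i. Z \<subseteq> Y" by (rule Suc.IH)
  qed
  then show ?case unfolding C(1) by (rule class_Union_in_hyper_level_Suc[OF C(2)])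
qed

lemma (in group) hyper_level_restrict:
  assumes "finite S" "T \<subseteq> S" "X \<in> hyper_level G S i" "X \<subseteq> T"
  shows "\<exists>Y \<in> hyper_level G T i. X \<subseteq> Y"
  using assms(3,4)
proof (induction i arbitrary: X)
  case 0
  then show ?case by (rule hyper_level_0_restrict[OF assms(1,2)])
next
  case (Suc i)
  from Suc.prems(1) obtain C where C: "X = \<Union> C"
    "C \<in> hyper_level G S i // link_equiv G (hyper_level G S i)" by (rule hyper_level_SucE)
  have "\<forall>Z \<in> C. \<exists>Y \<in> hyper_level G T i. Z \<subseteq> Y"
  proof
    fix Z assume "Z \<in> C"
    then have "Z \<in> hyper_level G S i" "Z \<subseteq> T"
      using link_class_subset[OF C(2)] C(1) Suc.prems(2) by auto
    then show "\<exists>Y \<in> hyper_level G T i. Z \<subseteq> Y" by (rule Suc.IH)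
  qed
  then show ?case unfolding C(1) by (rule class_Union_in_hyper_level_Suc[OF C(2)])
qed

text \<open>Within \<open>T\<close> there is no room for a proper superset of \<open>T\<close>, so here the comparison up to
  inclusion is sharp.\<close>

lemma (in group) hyper_level_self:
  assumes "finite S" "T \<in> hyper_level G S i"
  shows "T \<in> hyper_level G T i"
proof -
  obtain Y where Y: "Y \<in> hyper_level G T i" "T \<subseteq> Y"
    using hyper_level_restrict[OF assms(1) hyper_level_subset[OF assms(2)] assms(2)] by blast
  then have "Y = T" using hyper_level_subset[OF Y(1)] by blast
  with Y(1) show ?thesis by simp
qed

text \<open>If the union of a class contains no wide subset, its members are all slabs, and linked slabs
  are equal; so the class consists of a single slab.\<close>

lemma (in group) hyper_level_wide_or_slab:
  assumes "finite S" "S \<subseteq> carrier G" "X \<in> hyper_level G S i"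
  shows "(\<exists>V \<in> wide_subsets G S. V \<subseteq> X) \<or> X \<in> slab_subsets G S"
  using assms(3)
proof (induction i arbitrary: X)
  case 0
  then show ?case by auto
next
  case (Suc i)
  let ?L = "hyper_level G S i"
  from Suc.prems obtain C where C: "X = \<Union> C" "C \<in> ?L // link_equiv G ?L"
    by (rule hyper_level_SucE)
  show ?case
  proof (cases "\<exists>V \<in> wide_subsets G S. V \<subseteq> X")
    case False
    have slabs: "Z \<in> slab_subsets G S" if "Z \<in> C" for Z
    proof -
      have "Z \<in> ?L" "Z \<subseteq> X" using that C(1) link_class_subset[OF C(2)] by auto
      then show ?thesis using Suc.IH[of Z] False by (meson subset_trans)
    qed
    obtain X0 where X0: "X0 \<in> ?L" "C = link_equiv G ?L `` {X0}" using C(2) by (rule quotientE)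
    have C_iff: "Z \<in> C \<longleftrightarrow> (X0, Z) \<in> (nonspherical_link G ?L)\<^sup>* \<and> Z \<in> ?L" for Z
      using X0 unfolding link_equiv_def by auto
    have "Z = X0" if "(X0, Z) \<in> (nonspherical_link G ?L)\<^sup>*" for Z
      using that
    proof induction
      case (step Y Z)
      then have "Z \<in> ?L" "\<not> spherical G (Y \<inter> Z)" unfolding nonspherical_link_def by auto
      moreover have "(X0, Z) \<in> (nonspherical_link G ?L)\<^sup>*" using step.hyps by simp
      ultimately have "Y \<in> slab_subsets G S" "Z \<in> slab_subsets G S"
        using slabs C_iff X0(1) step.IH by simp_all
      then have "Y = Z"
        using \<open>\<not> spherical G (Y \<inter> Z)\<close> by (rule linked_slabs_equal[OF assms(1,2)])
      then show ?case using step.IH by simp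
    qed simp
    moreover have "X0 \<in> C" using C_iff X0(1) by simp
    ultimately have "C = {X0}" using C_iff by auto
    then show ?thesis using slabs C(1) by simp
  qed simp
qed


section \<open>Lowering the index by one\<close>

lemma hypergraph_index_eqI:
  assumes "wide_subsets G S \<noteq> {}" "first_level G S h"
  shows "hypergraph_index G S = enat h"
proof -
  have "(THE h. first_level G S h) = h"
    using assms(2) by (rule the_equality) (rule first_level_unique[OF _ assms(2)])
  moreover have "\<exists>k. first_level G S k" using assms(2) by (rule exI)
  ultimately show ?thesis using assms(1) unfolding hypergraph_index_def by simp
qed

lemma hypergraph_index_enatD:
  assumes "hypergraph_index G S = enat h"
  shows "wide_subsets G S \<noteq> {}" "first_level G S h"
proof -
  show "wide_subsets G S \<noteq> {}" using assms unfolding hypergraph_index_def by (auto split: if_splits)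
  have "\<exists>k. first_level G S k"
    using assms unfolding hypergraph_index_def by (auto split: if_splits)
  then obtain k where k: "first_level G S k" by (rule exE)
  then have "hypergraph_index G S = enat k"
    using \<open>wide_subsets G S \<noteq> {}\<close> by (intro hypergraph_index_eqI)
  then show "first_level G S h" using k assms by simp
qed

text \<open>If every member of level \<open>Suc k\<close> were contained in a member of level \<open>k\<close>, then a class
  of level \<open>Suc k\<close> with union \<open>S\<close> would yield a class of level \<open>k\<close> with union \<open>S\<close>.\<close>

lemma (in group) new_member_of_previous_level:
  assumes "S \<in> hyper_level G S (Suc (Suc k))" "S \<notin> hyper_level G S (Suc k)"
  shows "\<exists>T \<in> hyper_level G S (Suc k). \<forall>Y \<in> hyper_level G S k. \<not> T \<subseteq> Y"
proof (rule ccontr)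
  assume "\<not> ?thesis"
  then have up: "\<forall>T \<in> hyper_level G S (Suc k). \<exists>Y \<in> hyper_level G S k. T \<subseteq> Y"
    by (simp only: bex_simps ball_simps not_not simp_thms)
  from assms(1) obtain C where C: "S = \<Union> C"
    "C \<in> hyper_level G S (Suc k) // link_equiv G (hyper_level G S (Suc k))"
    by (rule hyper_level_SucE)
  have "\<forall>T \<in> C. \<exists>Y \<in> hyper_level G S k. T \<subseteq> Y"
    using up link_class_subset[OF C(2)] by (metis subsetD)
  then have "\<exists>Y \<in> hyper_level G S (Suc k). S \<subseteq> Y"
    by (subst C(1)) (rule class_Union_in_hyper_level_Suc[OF C(2)])
  then obtain Y where Y: "Y \<in> hyper_level G S (Suc k)" "S \<subseteq> Y" by (rule bexE)
  then have "Y = S" using hyper_level_subset[OF Y(1)] by simp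
  then show False using Y(1) assms(2) by simp
qed

text \<open>The subset is a member of level \<open>k\<close> of \<open>S\<close> that contains a wide subset and is not contained
  in any member of the level before. For \<open>k = 0\<close> any wide subset of \<open>S\<close> will do.\<close>

lemma (in group) hypergraph_index_predecessor:
  assumes "finite S" "S \<subseteq> carrier G" "hypergraph_index G S = enat (Suc k)"
  shows "\<exists>T \<subset> S. hypergraph_index G T = enat k"
proof -
  note S = hypergraph_index_enatD[OF assms(3)]
  have top: "S \<in> hyper_level G S (Suc k)" "S \<notin> hyper_level G S k"
    using S(2) unfolding first_level_def by blast+
  have "\<exists>T \<in> hyper_level G S k. (\<exists>V \<in> wide_subsets G S. V \<subseteq> T) \<and>
          (\<forall>j. k = Suc j \<longrightarrow> (\<forall>Y \<in> hyper_level G S j. \<not> T \<subseteq> Y))"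
  proof (cases k)
    case 0
    then show ?thesis using S(1) by fastforce
  next
    case (Suc j)
    obtain T where T: "T \<in> hyper_level G S k" "\<forall>Y \<in> hyper_level G S j. \<not> T \<subseteq> Y"
      using new_member_of_previous_level top unfolding Suc by metis
    have "T \<notin> slab_subsets G S"
    proof
      assume "T \<in> slab_subsets G S"
      then have T0: "T \<in> hyper_level G S 0" by simp
      have "T \<in> hyper_level G T 0" using assms(1) T0 by (rule hyper_level_self)
      \<comment> \<open>A slab belongs to all of its own levels, so at level \<open>k\<close> it cannot be new.\<close>
      then have "T \<in> hyper_level G T j"
        by (induction j) (auto intro: hyper_level_Suc simp del: hyper_level.simps)
      then have "\<exists>Y \<in> hyper_level G S j. T \<subseteq> Y"
        by (rule hyper_level_mono[OF assms(1) hyper_level_subset[OF T0]])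
      with T(2) show False by metis
    qed
    then have "\<exists>V \<in> wide_subsets G S. V \<subseteq> T"
      using hyper_level_wide_or_slab[OF assms(1,2) T(1)] by metis
    then show ?thesis using T Suc by (metis nat.inject)
  qed
  then obtain T V where T: "T \<in> hyper_level G S k" "V \<in> wide_subsets G S" "V \<subseteq> T"
    and new: "\<And>j Y. k = Suc j \<Longrightarrow> Y \<in> hyper_level G S j \<Longrightarrow> \<not> T \<subseteq> Y" by metis
  have TS: "T \<subseteq> S" using T(1) by (rule hyper_level_subset)
  have "V \<in> wide_products G T"
    using T wide_products_restrict[OF TS] wide_subset_product by blast
  then have "wide_subsets G T \<noteq> {}"
    using wide_subset_above[OF finite_subset[OF TS assms(1)]] by blast
  moreover have "first_level G T k"
    using hyper_level_self[OF assms(1) T(1)] hyper_level_mono[OF assms(1) TS] new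
    unfolding first_level_def by metis
  ultimately have "hypergraph_index G T = enat k" by (rule hypergraph_index_eqI)
  moreover have "T \<noteq> S" using T(1) top(2) by blast
  ultimately show ?thesis using TS by blast
qed

lemma (in group) hypergraph_index_chain:
  assumes "finite S" "S \<subseteq> carrier G" "hypergraph_index G S = enat h"
  shows "\<exists>T. T 0 = S \<and> (\<forall>i < h. T (Suc i) \<subset> T i) \<and>
           (\<forall>i \<le> h. hypergraph_index G (T i) = enat (h - i))"
  using assms
proof (induction h arbitrary: S)
  case 0
  then show ?case by (intro exI[of _ "\<lambda>_. S"]) auto
next
  case (Suc h)
  obtain S' where S': "S' \<subset> S" "hypergraph_index G S' = enat h"
    using hypergraph_index_predecessor[OF Suc.prems] by blast
  then have "finite S'" "S' \<subseteq> carrier G" using Suc.prems(1,2) finite_subset by auto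
  from Suc.IH[OF this S'(2)]
  obtain T where T: "T 0 = S'" "\<forall>i < h. T (Suc i) \<subset> T i"
    "\<forall>i \<le> h. hypergraph_index G (T i) = enat (h - i)"
    by (elim exE conjE)
  show ?case
  proof (intro exI[of _ "case_nat S T"] conjI allI impI)
    fix i assume "i < Suc h"
    then show "case_nat S T (Suc i) \<subset> case_nat S T i" using T S' by (cases i) auto
  next
    fix i assume "i \<le> Suc h"
    then show "hypergraph_index G (case_nat S T i) = enat (Suc h - i)"
      using T Suc.prems(3) by (cases i) auto
  qed simp
qed

theorem corollary1p9:
  fixes G (structure) and S :: "'g set" and m :: "'g \<Rightarrow> 'g \<Rightarrow> enat" and h :: nat
  assumes "coxeter_system G S m"
    and "hypergraph_index G S = enat h"
    and "1 \<le> h"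
  shows "\<exists>T :: nat \<Rightarrow> 'g set.
           T 1 \<subset> S \<and>
           (\<forall>i. 1 \<le> i \<and> i < h \<longrightarrow> T (Suc i) \<subset> T i) \<and>
           (\<forall>i. 1 \<le> i \<and> i \<le> h \<longrightarrow> hypergraph_index G (T i) = enat (h - i))"
proof -
  interpret coxeter_system G S m by (rule assms(1))
  have "S \<subseteq> carrier G" using presentation unfolding has_presentation_def by blast
  from hypergraph_index_chain[OF finite_generators this assms(2)]
  obtain T where T: "T 0 = S" "\<forall>i < h. T (Suc i) \<subset> T i"
    "\<forall>i \<le> h. hypergraph_index G (T i) = enat (h - i)"
    by (elim exE conjE)
  then have "T 1 \<subset> S" using assms(3) by (metis One_nat_def Suc_le_eq)
  with T(2,3) show ?thesis by (intro exI[of _ T]) simp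
qed

end
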